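(* Let $G=(V,E,W)$ be a weighted undirected graph with $V=\{1,\dots,d\}$ and $\tau_G>0$. Let $x\in\mathbb{T}^d$, let $X$ be the matrix of true phase differences and $\hat X = X\circ N$ the matrix of noisy phase differences, and let $\hat L = D - W\circ \hat X$. Let $\tilde x\in\mathbb{T}^d$ be a minimizer of the least squares problem $$\min_{v\in\mathbb{T}^d} v^*\hat L v ,$$ and let $z\in\mathbb{C}^d$ be a minimizer of the eigenvector relaxation $$\min_{v\in\mathbb{C}^d,\ \|v\|_2^2=d} v^*\hat L v .$$ Let $R\in\mathbb{C}^{d\times d}$ be given by $R_{\ell,j}=W_{\ell,j}^{1/2}$. Then $$\min_{\theta\in[0,2\pi)}\|\tilde x-e^{i\theta}x\|_2\le 2\,\frac{\|R\circ(\hat X-X)\|_F}{\sqrt{\tau_G}}$$ and $$\min_{\theta\in[0,2\pi)}\|\operatorname{sgn}(z)-e^{i\theta}x\|_2\le 2\,\frac{c_z\,\|R\circ(\hat X-X)\|_F}{\sqrt{\tau_G}},\qquad c_z:=\sqrt{2+2\|z\|_\infty^2}.$$ If, additionally, the inequality $$\|W\circ(\hat X-\tilde x\tilde x^* )\|_\infty<\frac{\tau_G}{1+\sqrt d}$$ holds, then $\tilde x\tilde x^*$ is the minimizer of the semidefinite program $$\min_{Z\in\mathcal{H}^d}\operatorname{tr}(\hat L Z)\quad\text{subject to } Z_{ii}=1 \text{ for all } i,\ Z\succeq 0 .$$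
   Context: $\mathbb{T}^d=\{v\in\mathbb{C}^d: |v_1|=\dots=|v_d|=1\}$; $\mathcal{H}^d$ is the space of $d\times d$ Hermitian matrices; $^*$ denotes complex conjugate (transpose); $\circ$ denotes the entrywise (Hadamard) product of matrices; $Z\succeq0$ means positive semidefinite. Norms: for a vector $v$, $\|v\|_2$ is the Euclidean norm and $\|v\|_\infty=\max_j|v_j|$. For a matrix $A$, $\|A\|_F=\sqrt{\operatorname{tr}(A^*A)}$ is the Frobenius norm and $\|A\|_\infty=\max_{\|v\|_2=1}\|Av\|_2$ denotes the spectral norm (not the entrywise maximum). Sign: for $\alpha\in\mathbb{C}$, $\operatorname{sgn}(\alpha)=\alpha/|\alpha|$ if $\alpha\ne0$ and $\operatorname{sgn}(0)=0$; applied entrywise to vectors. Graph: $E\subset\{1,\dots,d\}^2$ is a symmetric set of pairs $(\ell,j)$ with $\ell\neq j$. The weight matrix $W=(w_{\ell,j})$ is real, symmetric, entrywise nonnegative, with zero diagonal and $w_{\ell,j}=0$ for $(\ell,j)\notin E$. $\deg(\ell)=\sum_{j:(\ell,j)\in E}w_{\ell,j}$, $D=\operatorname{diag}(\deg(1),\dots,\deg(d))$, and $L_G=D-W$ is the graph Laplacian. Its eigenvalues are $0=\lambda_1\le\lambda_2\le\dots\le\lambda_d$, and $\tau_G=\lambda_2$ is the spectral gap. Phase matrices: given $x\in\mathbb{T}^d$, $X_{\ell,j}=x_\ell x_j^*$ for $(\ell,j)\in E$ and $X_{\ell,j}=0$ otherwise. The noise is a Hermitian matrix $N\in\mathcal{H}^d$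 with entries $N_{\ell,j}=e^{i\eta_{\ell,j}}$, $\eta_{\ell,j}\in(-\pi,\pi]$ (no distributional assumption), and $\hat X=X\circ N$. *)

theory Defs
  imports "HOL-Analysis.Analysis"
begin

type_synonym 'n cvec = "complex ^ 'n"
type_synonym 'n cmat = "complex ^ 'n ^ 'n"
type_synonym 'n rmat = "real ^ 'n ^ 'n"


subsection \<open>Vectors and matrices\<close>

definition torus :: "'n::finite cvec set" where
  "torus = {v. \<forall>i. cmod (v $ i) = 1}"

definition linf_norm :: "'n::finite cvec \<Rightarrow> real" where
  "linf_norm v = Max (range (\<lambda>j. cmod (v $ j)))"

text \<open>The library's \<^const>\<open>sgn\<close> on the vector type itself divides by the Euclidean norm of
  the whole vector; here it is applied to each entry.\<close>
definition sgn_vec :: "'n::finite cvec \<Rightarrow> 'n cvec" where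
  "sgn_vec v = (\<chi> i. sgn (v $ i))"

definition conj_transpose :: "'n::finite cmat \<Rightarrow> 'n cmat" where
  "conj_transpose A = (\<chi> i j. cnj (A $ j $ i))"

definition hermitian :: "'n::finite cmat \<Rightarrow> bool" where
  "hermitian A \<longleftrightarrow> conj_transpose A = A"

definition hadamard :: "'n::finite cmat \<Rightarrow> 'n cmat \<Rightarrow> 'n cmat"  (infixl \<open>\<odot>\<close> 70) where
  "A \<odot> B = (\<chi> i j. A $ i $ j * B $ i $ j)"

definition outer :: "'n::finite cvec \<Rightarrow> 'n cmat" where
  "outer v = (\<chi> i j. v $ i * cnj (v $ j))"

definition cmat_of :: "'n::finite rmat \<Rightarrow> 'n cmat" where
  "cmat_of A = (\<chi> i j. complex_of_real (A $ i $ j))"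

definition sesq_form :: "'n::finite cmat \<Rightarrow> 'n cvec \<Rightarrow> complex" where
  "sesq_form A v = (\<Sum>i\<in>UNIV. cnj (v $ i) * (A *v v) $ i)"

definition psd :: "'n::finite cmat \<Rightarrow> bool" where
  "psd A \<longleftrightarrow> hermitian A \<and> (\<forall>v. sesq_form A v \<in> \<real> \<and> 0 \<le> Re (sesq_form A v))"

definition frob_norm :: "'n::finite cmat \<Rightarrow> real" where
  "frob_norm A = sqrt (Re (trace (conj_transpose A ** A)))"

definition spectral_norm :: "'n::finite cmat \<Rightarrow> real" where
  "spectral_norm A = onorm ((*v) A)"


subsection \<open>Weighted graphs, Laplacian, spectral gap\<close>

definition weighted_graph :: "('n::finite \<times> 'n) set \<Rightarrow> 'n rmat \<Rightarrow> bool" where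
  "weighted_graph E W \<longleftrightarrow>
     sym E \<and> irrefl E \<and> transpose W = W \<and>
     (\<forall>l j. 0 \<le> W $ l $ j) \<and> (\<forall>l. W $ l $ l = 0) \<and>
     (\<forall>l j. (l, j) \<notin> E \<longrightarrow> W $ l $ j = 0)"

definition degree_matrix :: "('n::finite \<times> 'n) set \<Rightarrow> 'n rmat \<Rightarrow> 'n rmat" where
  "degree_matrix E W = (\<chi> l j. if l = j then (\<Sum>k | (l, k) \<in> E. W $ l $ k) else 0)"

definition laplacian :: "('n::finite \<times> 'n) set \<Rightarrow> 'n rmat \<Rightarrow> 'n rmat" where
  "laplacian E W = degree_matrix E W - W"

definition charpoly :: "'n::finite rmat \<Rightarrow> real poly" where
  "charpoly A = det (\<chi> i j. (if i = j then [:0, 1:] else 0) - [:A $ i $ j:])"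

text \<open>The real eigenvalues in nondecreasing order, repeated according to their multiplicity as
  roots of the characteristic polynomial. For a symmetric matrix the list has length
  \<open>CARD('n)\<close>.\<close>
definition eigenvalue_list :: "'n::finite rmat \<Rightarrow> real list" where
  "eigenvalue_list A = sorted_list_of_multiset (proots (charpoly A))"

text \<open>The second smallest eigenvalue: list positions count from 0. This is meaningful only for at
  least two vertices.\<close>
definition spectral_gap :: "('n::finite \<times> 'n) set \<Rightarrow> 'n rmat \<Rightarrow> real" where
  "spectral_gap E W = eigenvalue_list (laplacian E W) ! 1"


subsection \<open>Phase differences and optimization problems\<close>

definition phase_matrix :: "('n::finite \<times> 'n) set \<Rightarrow> 'n cvec \<Rightarrow> 'n cmat" where
  "phase_matrix E x = (\<chi> l j. if (l, j) \<in> E then x $ l * cnj (x $ j) else 0)"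

definition noisy_laplacian :: "('n::finite \<times> 'n) set \<Rightarrow> 'n rmat \<Rightarrow> 'n cmat \<Rightarrow> 'n cmat" where
  "noisy_laplacian E W Xh = cmat_of (degree_matrix E W) - cmat_of W \<odot> Xh"

text \<open>The objectives of the problems below are real because \<open>L\<close> is Hermitian in the
  intended use (and \<open>Z\<close> is too); \<^const>\<open>Re\<close> only changes the type.\<close>

definition least_squares_minimizer :: "'n::finite cmat \<Rightarrow> 'n cvec \<Rightarrow> bool" where
  "least_squares_minimizer L = is_arg_min (\<lambda>v. Re (sesq_form L v)) (\<lambda>v. v \<in> torus)"

definition eigenvector_minimizer :: "'n::finite cmat \<Rightarrow> 'n cvec \<Rightarrow> bool" where
  "eigenvector_minimizer L =
     is_arg_min (\<lambda>v. Re (sesq_form L v)) (\<lambda>v. (norm v)\<^sup>2 = real CARD('n))"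

definition sdp_minimizer :: "'n::finite cmat \<Rightarrow> 'n cmat \<Rightarrow> bool" where
  "sdp_minimizer L =
     is_arg_min (\<lambda>Z. Re (trace (L ** Z)))
       (\<lambda>Z. hermitian Z \<and> (\<forall>i. Z $ i $ i = 1) \<and> psd Z)"

text \<open>The number \<open>m\<close> is the attained minimum over \<open>\<theta> \<in> [0, 2\<pi>)\<close> of
  the distance from \<open>u\<close> to \<open>e\<^sup>i\<^sup>\<theta> x\<close>.\<close>
definition is_min_phase_dist :: "'n::finite cvec \<Rightarrow> 'n cvec \<Rightarrow> real \<Rightarrow> bool" where
  "is_min_phase_dist u x m \<longleftrightarrow>
     (\<exists>\<theta>. is_arg_min (\<lambda>\<theta>. norm (u - exp (\<i> * complex_of_real \<theta>) *s x)) (\<lambda>\<theta>. \<theta> \<in> {0..<2 * pi}) \<theta>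
        \<and> m = norm (u - exp (\<i> * complex_of_real \<theta>) *s x))"

end

theory Submission
  imports Defs
begin

text \<open>The Laplacian of the true phases is unitarily equivalent to the graph Laplacian, so its quadratic
  form at \<open>v\<close> is at least \<open>\<tau> (|v|\<^sup>2 - |x\<^sup>* v|\<^sup>2 / d)\<close>, whereas
  \<open>min\<^sub>\<theta> |v - e\<^sup>i\<^sup>\<theta> x|\<^sup>2 = 2 (d - |x\<^sup>* v|) \<le> 2 (d - |x\<^sup>* v|\<^sup>2 / d)\<close>. Both quadratic forms
  are sums of \<open>w |v\<^sub>l - Y\<^sub>l\<^sub>j v\<^sub>j|\<^sup>2\<close> over the edges, and so the triangle inequality in
  \<open>\<ell>\<^sup>2\<close> passes between the true and the noisy phases. For the semidefinite program, optimality of the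
  minimizer in each coordinate supplies a diagonal dual variable; subtracting it from the noisy
  Laplacian leaves a matrix that annihilates the minimizer and, by the perturbation bound, is positive
  definite on its orthogonal complement.\<close>

subsection \<open>Diagonalization of real symmetric matrices\<close>

lemma selfadjoint_eigenvector_exists:
  fixes f :: "'a::euclidean_space \<Rightarrow> 'a"
  assumes f: "linear f" and sa: "\<And>x y. f x \<bullet> y = x \<bullet> f y"
    and S: "subspace S" and inv: "\<And>x. x \<in> S \<Longrightarrow> f x \<in> S" and nz: "S \<noteq> {0}"
  obtains v c where "v \<in> S" "norm v = 1" "f v = c *\<^sub>R v"
proof -
  interpret linear f by fact
  obtain y where y: "y \<in> S" "y \<noteq> 0" using nz subspace_0[OF S] by blast
  have "y /\<^sub>R norm y \<in> sphere 0 1 \<inter> S"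
    using y S by (simp add: subspace_scale)
  then have ne: "sphere 0 1 \<inter> S \<noteq> {}" by blast
  have "compact (sphere 0 1 \<inter> S)"
    using S by (simp add: closed_subspace compact_Int_closed)
  moreover have "continuous_on (sphere 0 1 \<inter> S) (\<lambda>x. f x \<bullet> x)"
    by (intro continuous_intros linear_continuous_on linear_conv_bounded_linear[THEN iffD1] f)
  ultimately obtain v where v: "v \<in> S" "norm v = 1"
    and mx: "\<And>x. x \<in> S \<Longrightarrow> norm x = 1 \<Longrightarrow> f x \<bullet> x \<le> f v \<bullet> v"
    using continuous_attains_sup[OF _ ne, of "\<lambda>x. f x \<bullet> x"] by fastforce
  define c where "c = f v \<bullet> v"
  have vv: "v \<bullet> v = 1" using v by (simp add: norm_eq_1)
  have bound: "f x \<bullet> x \<le> c * (x \<bullet> x)" if "x \<in> S" for x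
  proof (cases "x = 0")
    case False
    have "f (x /\<^sub>R norm x) \<bullet> (x /\<^sub>R norm x) \<le> c"
      unfolding c_def using False that S by (intro mx) (simp_all add: subspace_scale)
    then show ?thesis using False
      by (simp add: scale field_simps power2_norm_eq_inner flip: power2_eq_square)
  qed (simp add: zero)
  have orth: "f v \<bullet> w = 0" if w: "w \<in> S" "v \<bullet> w = 0" for w
  proof (rule ccontr)
    assume ne0: "f v \<bullet> w \<noteq> 0"
    define a K where "a = f v \<bullet> w" and "K = c * (w \<bullet> w) - f w \<bullet> w"
    have ineq: "2 * t * a \<le> t\<^sup>2 * K" for t
    proof -
      have "f (v + t *\<^sub>R w) \<bullet> (v + t *\<^sub>R w) \<le> c * ((v + t *\<^sub>R w) \<bullet> (v + t *\<^sub>R w))"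
        using v w S by (intro bound) (simp add: subspace_add subspace_scale)
      moreover have "f w \<bullet> v = a" using sa[of w v] by (simp add: a_def inner_commute)
      ultimately show ?thesis using w vv
        by (simp add: a_def K_def add scale inner_add_left inner_add_right inner_commute[of w v]
            c_def[symmetric] power2_eq_square algebra_simps)
    qed
    have "a\<^sup>2 > 0" using ne0 by (simp add: a_def)
    have K: "K > 0"
      using ineq[of a] \<open>a\<^sup>2 > 0\<close>
      by (metis less_le_trans mult_2 power2_eq_square add_pos_pos distrib_right zero_less_mult_pos)
    have "2 * (a / K) * a \<le> (a / K)\<^sup>2 * K" by (rule ineq)
    then have "2 * a\<^sup>2 \<le> a\<^sup>2" using K by (simp add: field_simps power2_eq_square)
    then show False using \<open>a\<^sup>2 > 0\<close> by simp
  qed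
  define r where "r = f v - c *\<^sub>R v"
  have rS: "r \<in> S" using v inv S by (simp add: r_def subspace_diff subspace_scale)
  have rv: "v \<bullet> r = 0" by (simp add: r_def inner_diff_right c_def vv inner_commute)
  have "r \<bullet> r = f v \<bullet> r - c * (v \<bullet> r)" by (simp add: r_def inner_diff_left)
  also have "\<dots> = 0" using orth[OF rS rv] rv by simp
  finally have "f v = c *\<^sub>R v" by (simp add: r_def)
  with v that show ?thesis by blast
qed

lemma selfadjoint_orthonormal_eigenbasis:
  fixes f :: "'a::euclidean_space \<Rightarrow> 'a"
  assumes f: "linear f" and sa: "\<And>x y. f x \<bullet> y = x \<bullet> f y"
    and "subspace S" and "\<And>x. x \<in> S \<Longrightarrow> f x \<in> S"
  shows "\<exists>B. B \<subseteq> S \<and> pairwise orthogonal B \<and> (\<forall>b\<in>B. norm b = 1 \<and> (\<exists>c. f b = c *\<^sub>R b)) \<and> span B = S"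
  using assms(3,4)
proof (induction "dim S" arbitrary: S rule: less_induct)
  case less
  note S = less.prems(1) and inv = less.prems(2)
  show ?case
  proof (cases "S = {0}")
    case True
    then show ?thesis by (intro exI[of _ "{}"]) auto
  next
    case False
    then obtain v c where v: "v \<in> S" "norm v = 1" "f v = c *\<^sub>R v"
      using selfadjoint_eigenvector_exists[OF f sa S inv] by metis
    have vv: "v \<bullet> v = 1" using v by (simp add: norm_eq_1)
    define T where "T = S \<inter> {w. v \<bullet> w = 0}"
    have T: "subspace T" unfolding T_def by (intro subspace_inter S subspace_hyperplane)
    have "v \<notin> T" using vv by (simp add: T_def)
    moreover have "T \<subseteq> S" by (simp add: T_def)
    ultimately have "T \<subset> S" using v by blast
    then have lt: "dim T < dim S"
      using dim_psubset[of T S] S T by (metis span_eq_iff)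
    have "f w \<in> T" if "w \<in> T" for w
      using that inv[of w] sa[of v w] v(3) by (simp add: T_def)
    from less.hyps[OF lt T this] obtain B where B: "B \<subseteq> T" "pairwise orthogonal B"
      "\<forall>b\<in>B. norm b = 1 \<and> (\<exists>c. f b = c *\<^sub>R b)" "span B = T" by blast
    have "pairwise orthogonal (insert v B)"
      using B by (auto simp: pairwise_insert orthogonal_def T_def inner_commute)
    moreover have "span (insert v B) = S"
    proof
      show "span (insert v B) \<subseteq> S"
        using B v \<open>T \<subset> S\<close> S by (intro span_minimal) auto
      show "S \<subseteq> span (insert v B)"
      proof
        fix s assume s: "s \<in> S"
        have "s - (v \<bullet> s) *\<^sub>R v \<in> T"
          using s v S vv by (simp add: T_def subspace_diff subspace_scale inner_diff_right)
        then have "s - (v \<bullet> s) *\<^sub>R v \<in> span B" using B by simp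
        then show "s \<in> span (insert v B)" by (subst span_insert) blast
      qed
    qed
    ultimately show ?thesis
      using B v \<open>T \<subset> S\<close> by (intro exI[of _ "insert v B"]) auto
  qed
qed

lemma symmetric_matrix_diagonalization:
  fixes A :: "real^'n^'n"
  assumes "transpose A = A"
  obtains Q and \<Lambda> :: "'n \<Rightarrow> real" where "orthogonal_matrix Q"
    "A = Q ** (\<chi> i j. if i = j then \<Lambda> i else 0) ** transpose Q"
proof -
  have "\<exists>B. B \<subseteq> UNIV \<and> pairwise orthogonal B \<and>
    (\<forall>b\<in>B. norm b = 1 \<and> (\<exists>c. A *v b = c *\<^sub>R b)) \<and> span B = UNIV"
  proof (rule selfadjoint_orthonormal_eigenbasis)
    show "(A *v x) \<bullet> y = x \<bullet> (A *v y)" for x y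
      using dot_lmul_matrix[of x A y] vector_transpose_matrix[of x A] assms by simp
  qed simp_all
  then obtain B where B: "pairwise orthogonal B" "\<And>b. b \<in> B \<Longrightarrow> norm b = 1"
    "\<And>b. b \<in> B \<Longrightarrow> \<exists>c. A *v b = c *\<^sub>R b" "span B = UNIV" by auto
  have "independent B"
    using B(1) B(2)[of 0] by (intro pairwise_orthogonal_independent) auto
  then have "card B = CARD('n)" "finite B"
    using B(4) dim_span_eq_card_independent[of B] independent_bound[of B] by auto
  then obtain h where h: "bij_betw h (UNIV :: 'n set) B"
    by (metis finite_class.finite_UNIV finite_same_card_bij)
  then have hB: "h i \<in> B" for i by (auto simp: bij_betw_def)
  have "\<forall>i. \<exists>c. A *v h i = c *\<^sub>R h i" using B(3) hB by blast
  from choice[OF this] obtain \<Lambda> where \<Lambda>: "\<And>i. A *v h i = \<Lambda> i *\<^sub>R h i" by blast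
  define Q :: "real^'n^'n" where "Q = (\<chi> i j. h j $ i)"
  have hh: "h i \<bullet> h j = (if i = j then 1 else 0)" for i j
  proof (cases "i = j")
    case True
    then show ?thesis using B(2)[OF hB[of j]] by (simp add: norm_eq_1)
  next
    case False
    then have "h i \<noteq> h j" using h by (auto simp: bij_betw_def inj_on_def)
    then show ?thesis using False pairwiseD[OF B(1) hB hB] by (simp add: orthogonal_def)
  qed
  have QQ: "transpose Q ** Q = mat 1"
    using hh by (simp add: Q_def matrix_matrix_mult_def transpose_def mat_def inner_vec_def vec_eq_iff)
  then have orthQ: "orthogonal_matrix Q" by (simp add: orthogonal_matrix)
  have "(A ** Q) $ i $ j = (Q ** (\<chi> i j. if i = j then \<Lambda> i else 0)) $ i $ j" for i j
  proof -
    have "(A ** Q) $ i $ j = (A *v h j) $ i"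
      by (simp add: Q_def matrix_matrix_mult_def matrix_vector_mult_def)
    also have "\<dots> = Q $ i $ j * \<Lambda> j" by (simp add: \<Lambda> Q_def)
    finally show ?thesis by (simp add: matrix_matrix_mult_def if_distrib cong: if_cong)
  qed
  then have "A ** Q = Q ** (\<chi> i j. if i = j then \<Lambda> i else 0)" by (simp add: vec_eq_iff)
  then have "A ** (Q ** transpose Q) = Q ** (\<chi> i j. if i = j then \<Lambda> i else 0) ** transpose Q"
    by (simp add: matrix_mul_assoc)
  then have "A = Q ** (\<chi> i j. if i = j then \<Lambda> i else 0) ** transpose Q"
    using orthQ by (simp add: orthogonal_matrix_def)
  with orthQ that show ?thesis by blast
qed

lemma poly_charpoly: "poly (charpoly A) t = det (mat t - A)"
  unfolding charpoly_def det_def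
  by (simp add: poly_sum poly_prod mat_def if_distrib[of "\<lambda>p. poly p t"] cong: if_cong)

lemma charpoly_diagonalized:
  assumes Q: "orthogonal_matrix Q"
    and A: "A = Q ** (\<chi> i j. if i = j then \<Lambda> i else 0) ** transpose Q"
  shows "charpoly A = (\<Prod>i\<in>UNIV. [:- \<Lambda> i, 1:])"
proof -
  have "poly (charpoly A) t = poly (\<Prod>i\<in>UNIV. [:- \<Lambda> i, 1:]) t" for t
  proof -
    have QQ: "Q ** transpose Q = mat 1" using Q by (simp add: orthogonal_matrix_def)
    have "mat t - A = Q ** (mat t - (\<chi> i j. if i = j then \<Lambda> i else 0)) ** transpose Q"
    proof -
      have "Q ** mat t ** transpose Q = t *\<^sub>R (Q ** transpose Q)"
        by (simp add: vec_eq_iff matrix_matrix_mult_def mat_def if_distrib sum_distrib_left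
            mult_ac cong: if_cong)
      then have "Q ** mat t ** transpose Q = mat t"
        by (simp add: QQ vec_eq_iff mat_def)
      then show ?thesis unfolding A
        by (simp add: matrix_matrix_mult_def vec_eq_iff sum_subtractf algebra_simps)
    qed
    then have "det (mat t - A) = det (mat t - (\<chi> i j. if i = j then \<Lambda> i else 0)) * det (Q ** transpose Q)"
      by (simp add: det_mul)
    also have "\<dots> = (\<Prod>i\<in>UNIV. t - \<Lambda> i)"
      unfolding QQ det_I by (subst det_diagonal) (auto simp: mat_def)
    finally show ?thesis by (simp add: poly_charpoly poly_prod)
  qed
  then show ?thesis by (simp add: poly_eq_poly_eq_iff[symmetric] fun_eq_iff)
qed

lemma proots_prod_linear:
  fixes \<Lambda> :: "'b \<Rightarrow> 'a::idom"
  assumes "finite I"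
  shows "proots (\<Prod>i\<in>I. [:- \<Lambda> i, 1:]) = image_mset \<Lambda> (mset_set I)"
  using assms
proof (induction rule: finite_induct)
  case (insert i I)
  have "(\<Prod>i\<in>I. [:- \<Lambda> i, 1:]) \<noteq> 0" using insert.hyps by simp
  with insert show ?case by (simp add: proots_mult del: mult_pCons_left)
qed simp

lemma card_eigenvalues_less_second:
  fixes A :: "real^'n^'n" and \<Lambda> :: "'n \<Rightarrow> real"
  assumes "charpoly A = (\<Prod>i\<in>UNIV. [:- \<Lambda> i, 1:])" and two: "2 \<le> CARD('n)"
  shows "card {i. \<Lambda> i < eigenvalue_list A ! 1} \<le> 1"
proof -
  define xs where "xs = eigenvalue_list A"
  have m: "mset xs = image_mset \<Lambda> (mset_set UNIV)"
    by (simp add: xs_def eigenvalue_list_def assms(1) proots_prod_linear)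
  have s: "sorted xs" by (simp add: xs_def eigenvalue_list_def)
  have "length xs = CARD('n)" by (metis m size_image_mset size_mset size_mset_set)
  then obtain a b ys where xs: "xs = a # b # ys"
    using two by (metis Suc_le_length_iff numeral_2_eq_2)
  have "card {i. \<Lambda> i < xs ! 1} = size (filter_mset (\<lambda>x. x < xs ! 1) (image_mset \<Lambda> (mset_set UNIV)))"
    by (simp add: filter_mset_image_mset)
  also have "\<dots> = length (filter (\<lambda>x. x < xs ! 1) xs)"
    by (metis m mset_filter size_mset)
  also have "\<dots> \<le> 1"
  proof -
    have "filter (\<lambda>x. x < b) ys = []" using s xs by (auto simp: filter_empty_conv)
    then show ?thesis by (simp add: xs)
  qed
  finally show ?thesis by (simp add: xs_def)
qed

subsection \<open>The spectral gap as a lower bound of the quadratic form\<close>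

lemma transpose_matrix_diff: "transpose (A - B) = transpose A - transpose (B :: 'a::ab_group_add^'n^'m)"
  by (simp add: transpose_def vec_eq_iff)

lemma weighted_graph_symmetric: "weighted_graph E W \<Longrightarrow> W $ l $ j = W $ j $ l"
  unfolding weighted_graph_def transpose_def vec_eq_iff by (metis vec_lambda_beta)

lemma degree_matrix_eq:
  assumes "weighted_graph E W"
  shows "degree_matrix E W = (\<chi> l j. if l = j then (\<Sum>k\<in>UNIV. W $ l $ k) else 0)"
proof -
  have "(\<Sum>k | (l, k) \<in> E. W $ l $ k) = (\<Sum>k\<in>UNIV. W $ l $ k)" for l
    using assms by (intro sum.mono_neutral_left) (auto simp: weighted_graph_def)
  then show ?thesis by (simp add: degree_matrix_def vec_eq_iff)
qed

lemma laplacian_mult_nth: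
  assumes "weighted_graph E W"
  shows "(laplacian E W *v a) $ l = (\<Sum>j\<in>UNIV. W $ l $ j * (a $ l - a $ j))"
  by (simp add: laplacian_def degree_matrix_eq[OF assms] matrix_vector_mult_def left_diff_distrib
      right_diff_distrib sum_subtractf sum_distrib_right if_distrib[of "\<lambda>c. c * _"] cong: if_cong)

lemma laplacian_form:
  assumes W: "weighted_graph E W"
  shows "a \<bullet> (laplacian E W *v a) = (\<Sum>l\<in>UNIV. \<Sum>j\<in>UNIV. W $ l $ j * (a $ l - a $ j)\<^sup>2) / 2"
proof -
  have swap: "(\<Sum>l\<in>UNIV. \<Sum>j\<in>UNIV. W $ l $ j * (a $ j)\<^sup>2) = (\<Sum>l\<in>UNIV. \<Sum>j\<in>UNIV. W $ l $ j * (a $ l)\<^sup>2)"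
    by (subst sum.swap) (simp add: weighted_graph_symmetric[OF W])
  have "(\<Sum>l\<in>UNIV. \<Sum>j\<in>UNIV. W $ l $ j * (a $ l - a $ j)\<^sup>2) =
    (\<Sum>l\<in>UNIV. \<Sum>j\<in>UNIV. W $ l $ j * (a $ l)\<^sup>2) + (\<Sum>l\<in>UNIV. \<Sum>j\<in>UNIV. W $ l $ j * (a $ j)\<^sup>2)
    - 2 * (\<Sum>l\<in>UNIV. \<Sum>j\<in>UNIV. W $ l $ j * a $ l * a $ j)"
    by (simp add: sum.distrib sum_subtractf sum_distrib_left power2_diff algebra_simps)
  also have "\<dots> = 2 * ((\<Sum>l\<in>UNIV. \<Sum>j\<in>UNIV. W $ l $ j * (a $ l)\<^sup>2)
      - (\<Sum>l\<in>UNIV. \<Sum>j\<in>UNIV. W $ l $ j * a $ l * a $ j))"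
    unfolding swap by simp
  also have "\<dots> = 2 * (a \<bullet> (laplacian E W *v a))"
    by (simp add: laplacian_mult_nth[OF W] inner_vec_def algebra_simps sum_subtractf
        sum_distrib_left power2_eq_square)
  finally show ?thesis by simp
qed

lemma spectral_gap_form:
  fixes W :: "real^'n^'n"
  assumes W: "weighted_graph E W" and two: "2 \<le> CARD('n)" and pos: "spectral_gap E W > 0"
  shows "spectral_gap E W * ((norm a)\<^sup>2 - (\<Sum>i\<in>UNIV. a $ i)\<^sup>2 / CARD('n)) \<le> a \<bullet> (laplacian E W *v a)"
proof -
  define L where "L = laplacian E W"
  have "transpose (degree_matrix E W) = degree_matrix E W"
    by (auto simp: degree_matrix_def transpose_def vec_eq_iff)
  then have "transpose L = L"
    using W by (simp add: L_def laplacian_def transpose_matrix_diff weighted_graph_def)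
  then obtain Q \<Lambda> where Q: "orthogonal_matrix Q"
    and LQ: "L = Q ** (\<chi> i j. if i = j then \<Lambda> i else 0) ** transpose Q"
    using symmetric_matrix_diagonalization by blast
  have card: "card {i. \<Lambda> i < spectral_gap E W} \<le> 1"
    unfolding spectral_gap_def L_def[symmetric]
    using card_eigenvalues_less_second[OF charpoly_diagonalized[OF Q LQ] two] .
  define e :: "real^'n" where "e = (\<chi> i. 1)"
  define u b where "u = transpose Q *v e" and "b = transpose Q *v a"
  have iso: "(transpose Q *v v) \<bullet> (transpose Q *v w) = v \<bullet> w" for v w
    using Q orthogonal_transformation_matrix[of "(*v) (transpose Q)"]
    by (simp add: orthogonal_transformation_def)
  have diag: "(\<chi> i j. if i = j then \<Lambda> i else 0) *v w = (\<chi> i. \<Lambda> i * w $ i)" for w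
    by (simp add: matrix_vector_mult_def vec_eq_iff if_distrib[of "\<lambda>c. c * _"] cong: if_cong)
  have form: "v \<bullet> (L *v w) = (\<Sum>i\<in>UNIV. \<Lambda> i * (transpose Q *v v) $ i * (transpose Q *v w) $ i)" for v w
  proof -
    have "v \<bullet> (L *v w) = (transpose Q *v v) \<bullet> ((\<chi> i j. if i = j then \<Lambda> i else 0) *v (transpose Q *v w))"
      unfolding LQ matrix_vector_mul_assoc[symmetric] transpose_matrix_vector[of Q v]
      by (simp only: dot_lmul_matrix)
    then show ?thesis
      unfolding diag inner_vec_def by (simp add: mult_ac)
  qed
  have uu: "u \<bullet> u = CARD('n)" unfolding u_def iso by (simp add: e_def inner_vec_def)
  have ub: "u \<bullet> b = (\<Sum>i\<in>UNIV. a $ i)" unfolding u_def b_def iso by (simp add: e_def inner_vec_def)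
  have bb: "b \<bullet> b = (norm a)\<^sup>2" unfolding b_def iso by (simp add: power2_norm_eq_inner)
  have ker: "\<Lambda> i * u $ i = 0" for i
  proof -
    have "(Q *v axis i 1) \<bullet> (L *v e) = 0"
      by (simp add: L_def e_def inner_vec_def laplacian_mult_nth[OF W])
    moreover have "transpose Q *v (Q *v axis i 1) = axis i 1"
      using Q by (simp add: matrix_vector_mul_assoc orthogonal_matrix_def)
    ultimately show ?thesis
      unfolding form by (simp add: u_def axis_def if_distrib[of "\<lambda>c. c * _"] if_distrib[of "\<lambda>c. _ * c"] cong: if_cong)
  qed
  have "u \<noteq> 0" using uu by auto
  then obtain k where k: "u $ k \<noteq> 0" by (auto simp: vec_eq_iff)
  have k0: "\<Lambda> k = 0" using ker[of k] k by simp
  have gap: "spectral_gap E W \<le> \<Lambda> i" if "i \<noteq> k" for i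
  proof (rule ccontr)
    assume "\<not> ?thesis"
    then have "{i, k} \<subseteq> {i. \<Lambda> i < spectral_gap E W}" using k0 pos by auto
    then have "card {i, k} \<le> card {i. \<Lambda> i < spectral_gap E W}" by (intro card_mono) auto
    with card that show False by simp
  qed
  have u0: "u $ i = 0" if "i \<noteq> k" for i
    using ker[of i] gap[OF that] pos by auto
  have single: "u \<bullet> w = u $ k * w $ k" for w
    unfolding inner_vec_def using u0 by (simp add: sum.remove[of UNIV k])
  have "(\<Sum>i\<in>UNIV. a $ i)\<^sup>2 = CARD('n) * (b $ k)\<^sup>2"
    using ub uu by (simp add: single power_mult_distrib power2_eq_square[of "u $ k"] flip: ub)
  moreover have "(norm a)\<^sup>2 = (b $ k)\<^sup>2 + (\<Sum>i\<in>UNIV - {k}. (b $ i)\<^sup>2)"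
    unfolding bb[symmetric] inner_vec_def by (simp add: sum.remove[of UNIV k] power2_eq_square)
  ultimately have "(norm a)\<^sup>2 - (\<Sum>i\<in>UNIV. a $ i)\<^sup>2 / CARD('n) = (\<Sum>i\<in>UNIV - {k}. (b $ i)\<^sup>2)"
    by simp
  then have "spectral_gap E W * ((norm a)\<^sup>2 - (\<Sum>i\<in>UNIV. a $ i)\<^sup>2 / CARD('n))
    = (\<Sum>i\<in>UNIV - {k}. spectral_gap E W * (b $ i)\<^sup>2)" by (simp add: sum_distrib_left)
  also have "\<dots> \<le> (\<Sum>i\<in>UNIV - {k}. \<Lambda> i * (b $ i)\<^sup>2)"
    using gap by (intro sum_mono mult_right_mono) auto
  also have "\<dots> = a \<bullet> (L *v a)"
    unfolding form by (simp add: sum.remove[of UNIV k] k0 power2_eq_square b_def mult_ac)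
  finally show ?thesis by (simp add: L_def)
qed

lemma sum_cmod_power2: "(\<Sum>i\<in>UNIV. (cmod (v $ i))\<^sup>2) = (norm v)\<^sup>2"
  by (simp add: norm_vec_def L2_set_def sum_nonneg)

lemma spectral_gap_energy:
  fixes W :: "real^'n^'n" and g :: "complex^'n"
  assumes W: "weighted_graph E W" and two: "2 \<le> CARD('n)" and pos: "spectral_gap E W > 0"
  shows "spectral_gap E W * ((norm g)\<^sup>2 - (cmod (\<Sum>i\<in>UNIV. g $ i))\<^sup>2 / CARD('n))
    \<le> (\<Sum>l\<in>UNIV. \<Sum>j\<in>UNIV. W $ l $ j * (cmod (g $ l - g $ j))\<^sup>2) / 2"
proof -
  define a b :: "real^'n" where "a = (\<chi> i. Re (g $ i))" and "b = (\<chi> i. Im (g $ i))"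
  have n: "(norm g)\<^sup>2 = (norm a)\<^sup>2 + (norm b)\<^sup>2"
    by (simp add: sum_cmod_power2[symmetric] cmod_power2 sum.distrib a_def b_def norm_vec_def
        L2_set_def sum_nonneg)
  have s: "(cmod (\<Sum>i\<in>UNIV. g $ i))\<^sup>2 = (\<Sum>i\<in>UNIV. a $ i)\<^sup>2 + (\<Sum>i\<in>UNIV. b $ i)\<^sup>2"
    by (simp add: cmod_power2 a_def b_def)
  have e: "(\<Sum>l\<in>UNIV. \<Sum>j\<in>UNIV. W $ l $ j * (cmod (g $ l - g $ j))\<^sup>2) / 2
    = a \<bullet> (laplacian E W *v a) + b \<bullet> (laplacian E W *v b)"
    unfolding laplacian_form[OF W]
    by (simp add: cmod_power2 a_def b_def distrib_left sum.distrib add_divide_distrib)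
  show ?thesis unfolding n s e
    using spectral_gap_form[OF W two pos, of a] spectral_gap_form[OF W two pos, of b]
    by (simp add: add_divide_distrib algebra_simps)
qed

subsection \<open>Distances to the true phases\<close>

lemma cmod_diff_power2: "(cmod (a - b))\<^sup>2 = (cmod a)\<^sup>2 + (cmod b)\<^sup>2 - 2 * Re (cnj a * b)"
  unfolding cmod_power2 by (simp add: power2_eq_square algebra_simps)

lemma Re_complex_of_real_mult: "Re (of_real r * z) = r * Re z"
  by simp

lemma torus_cmod: "v \<in> torus \<Longrightarrow> cmod (v $ i) = 1"
  by (simp add: torus_def)

lemma torus_mult_cnj: "v \<in> torus \<Longrightarrow> v $ i * cnj (v $ i) = 1" "v \<in> torus \<Longrightarrow> cnj (v $ i) * v $ i = 1"
  using complex_norm_square[of "v $ i"] by (simp_all add: torus_def mult.commute)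

lemma torus_norm: "v \<in> torus \<Longrightarrow> (norm (v :: complex^'n))\<^sup>2 = CARD('n)"
  by (simp add: torus_def flip: sum_cmod_power2)

lemma sesq_form_expand: "sesq_form A v = (\<Sum>i\<in>UNIV. \<Sum>j\<in>UNIV. cnj (v $ i) * A $ i $ j * v $ j)"
  by (simp add: sesq_form_def matrix_vector_mult_def sum_distrib_left mult.assoc)

definition edge_energy :: "real^'n^'n \<Rightarrow> complex^'n^'n \<Rightarrow> complex^'n \<Rightarrow> real" where
  "edge_energy W Y v = (\<Sum>l\<in>UNIV. \<Sum>j\<in>UNIV. W $ l $ j * (cmod (v $ l - Y $ l $ j * v $ j))\<^sup>2) / 2"

lemma sesq_form_noisy_laplacian:
  assumes W: "weighted_graph E W"
    and Y: "\<And>l j. W $ l $ j \<noteq> 0 \<Longrightarrow> cmod (Y $ l $ j) = 1"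
  shows "Re (sesq_form (noisy_laplacian E W Y) v) = edge_energy W Y v"
proof -
  have swap: "(\<Sum>l\<in>UNIV. \<Sum>j\<in>UNIV. W $ l $ j * (cmod (v $ j))\<^sup>2) =
      (\<Sum>l\<in>UNIV. \<Sum>j\<in>UNIV. W $ l $ j * (cmod (v $ l))\<^sup>2)"
    by (subst sum.swap) (simp add: weighted_graph_symmetric[OF W])
  have entry: "W $ l $ j * (cmod (v $ l - Y $ l $ j * v $ j))\<^sup>2 =
      W $ l $ j * (cmod (v $ l))\<^sup>2 + W $ l $ j * (cmod (v $ j))\<^sup>2
      - 2 * (W $ l $ j * Re (cnj (v $ l) * Y $ l $ j * v $ j))" for l j
    by (cases "W $ l $ j = 0")
      (simp_all add: cmod_diff_power2 norm_mult Y algebra_simps del: complex_cnj_mult)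
  have diag: "Re (cnj (v $ l) * of_real r * v $ l) = r * (cmod (v $ l))\<^sup>2" for l r
    unfolding cmod_power2 by (simp add: power2_eq_square algebra_simps)
  have "sesq_form (noisy_laplacian E W Y) v = (\<Sum>l\<in>UNIV.
      cnj (v $ l) * of_real (\<Sum>j\<in>UNIV. W $ l $ j) * v $ l -
      (\<Sum>j\<in>UNIV. of_real (W $ l $ j) * (cnj (v $ l) * Y $ l $ j * v $ j)))"
    by (simp add: sesq_form_expand noisy_laplacian_def degree_matrix_eq[OF W] cmat_of_def
        hadamard_def algebra_simps sum_subtractf if_distrib[of of_real] if_distrib[of "\<lambda>c. _ * c"]
        cong: if_cong)
  then have "Re (sesq_form (noisy_laplacian E W Y) v) = (\<Sum>l\<in>UNIV. \<Sum>j\<in>UNIV. W $ l $ j * (cmod (v $ l))\<^sup>2)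
      - (\<Sum>l\<in>UNIV. \<Sum>j\<in>UNIV. W $ l $ j * Re (cnj (v $ l) * Y $ l $ j * v $ j))"
    by (simp only: minus_complex.sel diag Re_sum Re_complex_of_real_mult sum_subtractf
        sum_distrib_right)
  then show ?thesis
    unfolding edge_energy_def entry sum_subtractf sum.distrib sum_distrib_left[symmetric] swap by simp
qed

lemma edge_energy_gap:
  fixes W :: "real^'n^'n" and x u :: "complex^'n"
  assumes W: "weighted_graph E W" and two: "2 \<le> CARD('n)" and pos: "spectral_gap E W > 0"
    and x: "x \<in> torus"
  shows "spectral_gap E W * ((norm u)\<^sup>2 - (cmod (\<Sum>i\<in>UNIV. cnj (x $ i) * u $ i))\<^sup>2 / CARD('n))
    \<le> edge_energy W (outer x) u"
proof -
  define g :: "complex^'n" where "g = (\<chi> i. cnj (x $ i) * u $ i)"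
  have n: "(norm g)\<^sup>2 = (norm u)\<^sup>2"
    using x by (simp add: g_def norm_mult torus_cmod flip: sum_cmod_power2)
  have "cmod (g $ l - g $ j) = cmod (u $ l - outer x $ l $ j * u $ j)" for l j
  proof -
    have "x $ l * (g $ l - g $ j) = u $ l - outer x $ l $ j * u $ j"
      by (simp add: g_def outer_def right_diff_distrib torus_mult_cnj[OF x] flip: mult.assoc)
    then show ?thesis using x by (metis mult_1 norm_mult torus_cmod)
  qed
  with spectral_gap_energy[OF W two pos, of g] n show ?thesis
    by (simp add: edge_energy_def) (simp add: g_def)
qed

lemma edge_energy_L2_set:
  fixes W :: "real^'n^'n"
  assumes "\<And>l j. 0 \<le> W $ l $ j"
  shows "sqrt (2 * edge_energy W Y v) =
    L2_set (\<lambda>(l, j). sqrt (W $ l $ j) * cmod (v $ l - Y $ l $ j * v $ j)) UNIV"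
  using assms
  by (simp add: edge_energy_def L2_set_def sum.cartesian_product power_mult_distrib
      case_prod_beta flip: UNIV_Times_UNIV)

lemma frob_norm_L2_set: "frob_norm A = L2_set (\<lambda>(l, j). cmod (A $ l $ j)) UNIV"
proof -
  have "Re (trace (conj_transpose A ** A)) = (\<Sum>i\<in>UNIV. \<Sum>k\<in>UNIV. (cmod (A $ k $ i))\<^sup>2)"
    unfolding cmod_power2
    by (simp add: trace_def conj_transpose_def matrix_matrix_mult_def power2_eq_square)
  also have "\<dots> = (\<Sum>k\<in>UNIV. \<Sum>i\<in>UNIV. (cmod (A $ k $ i))\<^sup>2)" by (rule sum.swap)
  finally show ?thesis
    by (simp add: frob_norm_def L2_set_def sum.cartesian_product case_prod_beta flip: UNIV_Times_UNIV)
qed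

lemma cnj_sgn_mult: "cnj (sgn z) * z = of_real (cmod z)"
proof -
  have "cnj (sgn z) * z = of_real ((cmod z)\<^sup>2) / of_real (cmod z)"
    unfolding complex_norm_square by (simp add: sgn_eq mult.commute)
  then show ?thesis by (simp add: power2_eq_square)
qed

lemma is_min_phase_dist_explicit:
  fixes u x :: "complex^'n"
  shows "is_min_phase_dist u x
    (sqrt ((norm u)\<^sup>2 + (norm x)\<^sup>2 - 2 * cmod (\<Sum>i\<in>UNIV. cnj (x $ i) * u $ i)))"
proof -
  define s where "s = (\<Sum>i\<in>UNIV. cnj (x $ i) * u $ i)"
  have dist: "(norm (u - c *s x))\<^sup>2 = (norm u)\<^sup>2 + (norm x)\<^sup>2 - 2 * Re (cnj c * s)" if "cmod c = 1" for c
  proof -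
    have "(cmod (u $ i - c * x $ i))\<^sup>2 = (cmod (u $ i))\<^sup>2 + (cmod (x $ i))\<^sup>2 - 2 * Re (cnj c * (cnj (x $ i) * u $ i))" for i
      using that cmod_diff_power2[of "c * x $ i" "u $ i"]
      by (simp add: norm_mult norm_minus_commute mult.assoc)
    moreover have "2 * Re (cnj c * s) = (\<Sum>i\<in>UNIV. 2 * Re (cnj c * (cnj (x $ i) * u $ i)))"
      by (simp only: s_def sum_distrib_left Re_sum)
    ultimately show ?thesis
      by (simp add: sum.distrib sum_subtractf flip: sum_cmod_power2)
  qed
  define c where "c = (if s = 0 then 1 else sgn s)"
  have c: "cmod c = 1" "cnj c * s = of_real (cmod s)"
    by (simp_all add: c_def norm_sgn cnj_sgn_mult)
  define \<theta> where "\<theta> = Arg2pi c"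
  have \<theta>: "0 \<le> \<theta>" "\<theta> < 2 * pi" by (simp_all add: \<theta>_def Arg2pi_ge_0 Arg2pi_lt_2pi)
  have e: "exp (\<i> * of_real \<theta>) = c" using Arg2pi_eq[of c] c by (simp add: \<theta>_def)
  have "norm (u - c *s x) \<le> norm (u - exp (\<i> * of_real t) *s x)" for t
  proof -
    have "Re (cnj (exp (\<i> * of_real t)) * s) \<le> cmod s"
      using complex_Re_le_cmod[of "cnj (exp (\<i> * of_real t)) * s"] by (simp add: norm_mult)
    then have "(norm (u - c *s x))\<^sup>2 \<le> (norm (u - exp (\<i> * of_real t) *s x))\<^sup>2"
      using c by (simp add: dist)
    then show ?thesis by (simp add: power2_le_iff_abs_le)
  qed
  moreover have "norm (u - c *s x) = sqrt ((norm u)\<^sup>2 + (norm x)\<^sup>2 - 2 * cmod s)"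
    using dist[OF c(1)] c(2) by (metis Re_complex_of_real norm_ge_zero real_sqrt_unique)
  ultimately show ?thesis
    unfolding is_min_phase_dist_def is_arg_min_def s_def[symmetric]
    by (intro exI[of _ \<theta>]) (auto simp: e not_less \<theta>)
qed

text \<open>The root of twice the energy for \<open>outer x\<close> exceeds the one for \<open>Y\<close> by at most
  \<open>M * F\<close>, and the latter is at most \<open>F\<close> because \<open>x\<close> is a competitor.\<close>
lemma phase_dist_bound:
  fixes W :: "real^'n^'n" and x v :: "complex^'n"
  assumes W: "weighted_graph E W" and two: "2 \<le> CARD('n)" and pos: "spectral_gap E W > 0"
    and x: "x \<in> torus" and v: "(norm v)\<^sup>2 = CARD('n)"
    and M: "\<And>j. cmod (v $ j) \<le> M"
    and le: "edge_energy W Y v \<le> edge_energy W Y x"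
    and F: "F = L2_set (\<lambda>(l, j). sqrt (W $ l $ j) * cmod (Y $ l $ j - outer x $ l $ j)) UNIV"
  obtains m where "is_min_phase_dist v x m" "m \<le> (1 + M) * F / sqrt (spectral_gap E W)"
proof -
  have Wnn: "0 \<le> W $ l $ j" for l j using W by (simp add: weighted_graph_def)
  have M0: "0 \<le> M" using M[of undefined] norm_ge_zero[of "v $ undefined"] by linarith
  have F0: "0 \<le> F" unfolding F by (rule L2_set_nonneg)
  define s where "s = cmod (\<Sum>i\<in>UNIV. cnj (x $ i) * v $ i)"
  define d where "d = real CARD('n)"
  define \<tau> where "\<tau> = spectral_gap E W"
  have "sqrt (2 * edge_energy W Y x) = F"
  proof -
    have "cmod (x $ l - Y $ l $ j * x $ j) = cmod (Y $ l $ j - outer x $ l $ j)" for l j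
    proof -
      have "(outer x $ l $ j - Y $ l $ j) * x $ j = x $ l - Y $ l $ j * x $ j"
        by (simp add: outer_def left_diff_distrib torus_mult_cnj[OF x] mult.assoc)
      then show ?thesis using x by (metis mult.right_neutral norm_minus_commute norm_mult torus_cmod)
    qed
    then show ?thesis unfolding edge_energy_L2_set[OF Wnn] F by simp
  qed
  then have EY: "sqrt (2 * edge_energy W Y v) \<le> F"
    using le by (metis mult_left_mono real_sqrt_le_mono zero_le_numeral)
  have "sqrt (2 * edge_energy W (outer x) v) \<le> L2_set (\<lambda>p.
      (case p of (l, j) \<Rightarrow> sqrt (W $ l $ j) * cmod (v $ l - Y $ l $ j * v $ j)) +
      (case p of (l, j) \<Rightarrow> M * (sqrt (W $ l $ j) * cmod (Y $ l $ j - outer x $ l $ j)))) UNIV"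
    unfolding edge_energy_L2_set[OF Wnn]
  proof (rule L2_set_mono, goal_cases)
    case (1 p)
    obtain l j where p: "p = (l, j)" by force
    have "v $ l - outer x $ l $ j * v $ j = (v $ l - Y $ l $ j * v $ j) + (Y $ l $ j - outer x $ l $ j) * v $ j"
      by (simp add: algebra_simps)
    then have "cmod (v $ l - outer x $ l $ j * v $ j)
      \<le> cmod (v $ l - Y $ l $ j * v $ j) + cmod (Y $ l $ j - outer x $ l $ j) * cmod (v $ j)"
      by (metis norm_mult norm_triangle_ineq)
    also have "\<dots> \<le> cmod (v $ l - Y $ l $ j * v $ j) + cmod (Y $ l $ j - outer x $ l $ j) * M"
      by (intro add_left_mono mult_left_mono M) simp
    finally have "sqrt (W $ l $ j) * cmod (v $ l - outer x $ l $ j * v $ j)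
      \<le> sqrt (W $ l $ j) * (cmod (v $ l - Y $ l $ j * v $ j) + cmod (Y $ l $ j - outer x $ l $ j) * M)"
      using Wnn[of l j] by (intro mult_left_mono) simp_all
    then show ?case by (simp add: p distrib_left mult_ac)
  next
    case (2 p)
    then show ?case using Wnn by (auto split: prod.split)
  qed
  also have "\<dots> \<le> sqrt (2 * edge_energy W Y v) + M * F"
    unfolding edge_energy_L2_set[OF Wnn] F
    by (rule order_trans[OF L2_set_triangle_ineq])
      (simp add: L2_set_right_distrib[OF M0] case_prod_unfold)
  also have "\<dots> \<le> (1 + M) * F" using EY by (simp add: algebra_simps)
  finally have "2 * edge_energy W (outer x) v \<le> ((1 + M) * F)\<^sup>2"
    by (rule sqrt_le_D)
  then have gap: "2 * (\<tau> * (d - s\<^sup>2 / d)) \<le> ((1 + M) * F)\<^sup>2"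
    using edge_energy_gap[OF W two pos x, of v] v by (simp add: s_def d_def \<tau>_def)
  define m where "m = sqrt (2 * d - 2 * s)"
  have min: "is_min_phase_dist v x m"
    using is_min_phase_dist_explicit[of v x] v torus_norm[OF x] by (simp add: m_def s_def d_def)
  have "0 \<le> m" using min by (auto simp: is_min_phase_dist_def)
  then have sd: "s \<le> d" by (simp add: m_def)
  have d0: "d > 0" using two by (simp add: d_def)
  have "s\<^sup>2 / d \<le> s"
    using d0 sd by (simp add: s_def power2_eq_square divide_le_eq mult_left_mono)
  then have "\<tau> * (2 * d - 2 * s) \<le> 2 * (\<tau> * (d - s\<^sup>2 / d))"
    using pos by (simp add: \<tau>_def mult_left_mono)
  with gap have "\<tau> * (2 * d - 2 * s) \<le> ((1 + M) * F)\<^sup>2" by linarith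
  then have "2 * d - 2 * s \<le> ((1 + M) * F)\<^sup>2 / \<tau>"
    using pos by (simp add: \<tau>_def le_divide_eq mult.commute)
  then have "m \<le> sqrt (((1 + M) * F)\<^sup>2 / \<tau>)" unfolding m_def by (rule real_sqrt_le_mono)
  also have "\<dots> = (1 + M) * F / sqrt \<tau>"
    using M0 F0 by (simp add: real_sqrt_divide)
  finally show ?thesis using that min by (simp add: \<tau>_def)
qed

lemma cmod_sgn_diff_le:
  assumes "cmod c = 1"
  shows "cmod (sgn w - c) \<le> 2 * cmod (w - c)"
proof (cases "w = 0")
  case False
  have "sgn w - w = of_real (1 - cmod w) * sgn w"
    using False by (simp add: sgn_eq field_simps)
  then have "cmod (sgn w - w) = \<bar>1 - cmod w\<bar>"
    using False by (simp only: norm_mult norm_of_real norm_sgn) simp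
  also have "\<dots> \<le> cmod (w - c)"
    using norm_triangle_ineq3[of c w] assms by (simp add: norm_minus_commute)
  finally show ?thesis
    using norm_triangle_ineq[of "sgn w - w" "w - c"] by simp
qed (simp add: assms)

lemma norm_sgn_vec_diff_le:
  assumes "c \<in> torus"
  shows "norm (sgn_vec z - c) \<le> 2 * norm (z - c)"
proof -
  have "norm (sgn_vec z - c) \<le> norm (2 *\<^sub>R (z - c))"
    by (rule norm_le_componentwise_cart)
      (simp add: sgn_vec_def cmod_sgn_diff_le torus_cmod[OF assms])
  then show ?thesis by simp
qed

subsection \<open>The semidefinite program\<close>

lemma hermitian_nth: "hermitian A \<Longrightarrow> cnj (A $ i $ j) = A $ j $ i"
  by (simp add: hermitian_def conj_transpose_def vec_eq_iff)

lemma hermitianI: "(\<And>i j. cnj (A $ i $ j) = A $ j $ i) \<Longrightarrow> hermitian A"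
  by (simp add: hermitian_def conj_transpose_def vec_eq_iff)

lemma hermitian_diag: "hermitian A \<Longrightarrow> A $ i $ i = of_real (Re (A $ i $ i))"
  using hermitian_nth[of A i i] by (simp add: complex_eq_iff)

lemma cnj_sesq_form:
  assumes "hermitian A"
  shows "cnj (sesq_form A v) = sesq_form A v"
  unfolding sesq_form_expand
  by (subst sum.swap) (simp add: hermitian_nth[OF assms] mult_ac)

lemma psd_iff: "psd A \<longleftrightarrow> hermitian A \<and> (\<forall>v. 0 \<le> Re (sesq_form A v))"
  unfolding psd_def using cnj_sesq_form Reals_cnj_iff by metis

lemma sesq_form_add:
  assumes "hermitian A"
  shows "Re (sesq_form A (u + w)) =
    Re (sesq_form A u) + Re (sesq_form A w) + 2 * Re (\<Sum>i\<in>UNIV. cnj (w $ i) * (A *v u) $ i)"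
proof -
  have "cnj (\<Sum>i\<in>UNIV. cnj (w $ i) * (A *v u) $ i) = (\<Sum>i\<in>UNIV. cnj (u $ i) * (A *v w) $ i)"
    unfolding matrix_vector_mult_def vec_lambda_beta sum_distrib_left cnj_sum
    by (subst sum.swap) (simp add: hermitian_nth[OF assms] mult_ac)
  then have "Re (\<Sum>i\<in>UNIV. cnj (u $ i) * (A *v w) $ i) = Re (\<Sum>i\<in>UNIV. cnj (w $ i) * (A *v u) $ i)"
    by (metis cnj.sel(1))
  then show ?thesis
    by (simp add: sesq_form_def matrix_vector_right_distrib distrib_left distrib_right sum.distrib
        del: Re_sum)
qed

lemma sum_cnj_axis: "(\<Sum>k\<in>UNIV. cnj (axis i a $ k) * f k) = cnj a * f i"
  by (simp add: axis_def if_distrib[of cnj] if_distrib[of "\<lambda>c. c * _"] cong: if_cong)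

lemma mult_axis_nth: "((A :: complex^'n^'n) *v axis i a) $ k = A $ k $ i * a"
  by (simp add: matrix_vector_mult_def axis_def if_distrib[of "\<lambda>c. _ * c"] cong: if_cong)

lemma sesq_form_axis: "sesq_form A (axis i a) = (cmod a)\<^sup>2 * A $ i $ i"
  unfolding sesq_form_def sum_cnj_axis mult_axis_nth complex_norm_square by simp

lemma sesq_form_add_axis:
  assumes "hermitian A"
  shows "Re (sesq_form A (u + axis i a)) =
    Re (sesq_form A u) + (cmod a)\<^sup>2 * Re (A $ i $ i) + 2 * Re (cnj a * (A *v u) $ i)"
  unfolding sesq_form_add[OF assms] sum_cnj_axis sesq_form_axis
  by (simp only: Re_complex_of_real_mult)

lemma sesq_form_axis_axis:
  assumes "hermitian A"
  shows "Re (sesq_form A (axis j b + axis i a)) =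
    (cmod b)\<^sup>2 * Re (A $ j $ j) + (cmod a)\<^sup>2 * Re (A $ i $ i) + 2 * Re (cnj a * A $ i $ j * b)"
  unfolding sesq_form_add_axis[OF assms] mult_axis_nth sesq_form_axis
  by (simp only: Re_complex_of_real_mult mult.assoc)

lemma psd_diag_nonneg:
  assumes "psd A"
  shows "0 \<le> Re (A $ i $ i)"
proof -
  have "0 \<le> Re (sesq_form A (axis i 1))" using assms by (simp add: psd_iff)
  then show ?thesis by (simp add: sesq_form_axis)
qed

lemma psd_zero_diag:
  assumes A: "psd A" and "A $ i $ i = 0"
  shows "A $ i $ j = 0"
proof (rule ccontr)
  assume nz: "A $ i $ j \<noteq> 0"
  define r where "r = (cmod (A $ i $ j))\<^sup>2"
  have r: "r > 0" using nz by (simp add: r_def)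
  define t where "t = (Re (A $ j $ j) + 1) / (2 * r)"
  have "cnj (- (of_real t * A $ i $ j)) * A $ i $ j * 1 = of_real (- (t * r))"
    unfolding r_def using complex_norm_square[of "A $ i $ j"] by (simp add: mult_ac)
  then have "Re (sesq_form A (axis j 1 + axis i (- (of_real t * A $ i $ j)))) = Re (A $ j $ j) - 2 * t * r"
    using assms by (simp only: psd_iff sesq_form_axis_axis) simp
  also have "\<dots> < 0" using r by (simp add: t_def)
  finally show False using A by (metis linorder_not_less psd_iff)
qed

lemma trace_mult_expand: "trace (A ** B) = (\<Sum>i\<in>UNIV. \<Sum>k\<in>UNIV. A $ i $ k * B $ k $ i)"
  by (simp add: trace_def matrix_matrix_mult_def)

lemma trace_mult_outer: "trace (A ** outer v) = sesq_form A v"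
  by (simp add: trace_mult_expand sesq_form_expand outer_def mult_ac)

lemma trace_outer_mult: "trace (outer v ** A) = sesq_form A v"
  by (subst trace_mul_sym) (rule trace_mult_outer)

text \<open>Induction on the number of nonzero diagonal entries of \<open>Z\<close>: one elimination step of
  the Cholesky decomposition splits off a rank-one part and leaves a Schur complement, which is
  again positive semidefinite and has one nonzero diagonal entry less.\<close>
lemma trace_mult_psd_nonneg:
  assumes P: "\<And>v. 0 \<le> Re (sesq_form P v)" and "psd Z"
  shows "0 \<le> Re (trace (P ** Z))"
  using \<open>psd Z\<close>
proof (induction "card {i. Z $ i $ i \<noteq> 0}" arbitrary: Z rule: less_induct)
  case less
  note Z = less.prems
  show ?case
  proof (cases "\<exists>i. Z $ i $ i \<noteq> 0")
    case False
    then have "Z $ i $ j = 0" for i j using psd_zero_diag[OF Z] by blast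
    then show ?thesis by (simp add: trace_mult_expand)
  next
    case True
    then obtain i where i: "Z $ i $ i \<noteq> 0" by blast
    have herm: "hermitian Z" using Z by (simp add: psd_iff)
    define r where "r = Re (Z $ i $ i)"
    have zr: "Z $ i $ i = of_real r" unfolding r_def by (rule hermitian_diag[OF herm])
    have "r \<noteq> 0" using i zr by auto
    moreover have "0 \<le> r" unfolding r_def by (rule psd_diag_nonneg[OF Z])
    ultimately have r: "r > 0" by simp
    define u where "u = column i Z"
    define Y where "Y = Z - (1 / r) *\<^sub>R outer u"
    have Ynth: "Y $ k $ l = Z $ k $ l - Z $ k $ i * Z $ i $ l / of_real r" for k l
      by (simp add: Y_def u_def column_def outer_def hermitian_nth[OF herm]) (simp add: scaleR_conv_of_real)
    have Yform: "sesq_form Y v = sesq_form Z v - of_real ((cmod ((Z *v v) $ i))\<^sup>2 / r)" for v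
    proof -
      have "cnj ((Z *v v) $ i) = (\<Sum>k\<in>UNIV. cnj (v $ k) * Z $ k $ i)"
        by (simp add: matrix_vector_mult_def hermitian_nth[OF herm] mult.commute)
      moreover have "sesq_form Y v = sesq_form Z v
        - (\<Sum>k\<in>UNIV. cnj (v $ k) * Z $ k $ i) * (Z *v v) $ i / of_real r"
        by (simp add: sesq_form_expand Ynth matrix_vector_mult_def sum_product sum_divide_distrib
            algebra_simps sum_subtractf) (rule sum.swap)
      ultimately show ?thesis by (simp only: of_real_divide complex_norm_square mult.commute)
    qed
    have Y: "psd Y"
      unfolding psd_iff
    proof (intro conjI allI)
      show "hermitian Y"
        by (rule hermitianI) (simp add: Ynth hermitian_nth[OF herm] mult.commute)
      show "0 \<le> Re (sesq_form Y v)" for v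
      proof -
        define b where "b = (Z *v v) $ i"
        define a where "a = - (b / of_real r)"
        have ab: "cnj a * b = - of_real ((cmod b)\<^sup>2 / r)"
          unfolding a_def by (simp only: of_real_divide complex_norm_square) (simp add: mult.commute)
        have aa: "(cmod a)\<^sup>2 * r = (cmod b)\<^sup>2 / r"
          using r by (simp add: a_def norm_divide power_divide power2_eq_square)
        have "Re (sesq_form Z (v + axis i a)) = Re (sesq_form Z v) - (cmod b)\<^sup>2 / r"
          unfolding sesq_form_add_axis[OF herm] b_def[symmetric] r_def[symmetric] ab aa by simp
        then show ?thesis
          using Z unfolding Yform b_def[symmetric] by (metis Re_complex_of_real minus_complex.sel(1) psd_iff)
      qed
    qed
    have "{k. Y $ k $ k \<noteq> 0} \<subset> {k. Z $ k $ k \<noteq> 0}"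
    proof
      show "{k. Y $ k $ k \<noteq> 0} \<subseteq> {k. Z $ k $ k \<noteq> 0}"
        using psd_zero_diag[OF Z] by (auto simp: Ynth)
      have "Y $ i $ i = 0" using r by (simp add: Ynth zr)
      then show "{k. Y $ k $ k \<noteq> 0} \<noteq> {k. Z $ k $ k \<noteq> 0}" using i by blast
    qed
    then have "0 \<le> Re (trace (P ** Y))"
      by (intro less.hyps Y psubset_card_mono) auto
    moreover have "trace (P ** Z) = trace (P ** Y) + of_real (1 / r) * trace (P ** outer u)"
    proof -
      have "Z $ k $ l = Y $ k $ l + of_real (1 / r) * outer u $ k $ l" for k l
        by (simp add: Y_def) (simp add: scaleR_conv_of_real)
      then show ?thesis
        by (simp add: trace_mult_expand algebra_simps sum.distrib sum_distrib_left sum_divide_distrib)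
    qed
    moreover have "Re (of_real (1 / r) * trace (P ** outer u)) = 1 / r * Re (sesq_form P u)"
      by (simp only: Re_complex_of_real_mult trace_mult_outer)
    ultimately show ?thesis using P[of u] r by simp
  qed
qed

lemma of_real_cmod_eqI: "cmod z \<le> Re z \<Longrightarrow> z = of_real (cmod z)"
  using complex_Re_le_cmod[of z] cmod_power2[of z] by (simp add: complex_eq_iff)

lemma torus_maximizer_mult:
  assumes B: "hermitian B" "\<And>i. B $ i $ i = 0" and v: "v \<in> torus"
    and max: "\<And>w. w \<in> torus \<Longrightarrow> Re (sesq_form B w) \<le> Re (sesq_form B v)"
  shows "(B *v v) $ i = of_real (cmod ((B *v v) $ i)) * v $ i"
proof (cases "(B *v v) $ i = 0")
  case False
  define b where "b = (B *v v) $ i"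
  have "v + axis i (sgn b - v $ i) \<in> torus"
    using v False by (auto simp: torus_def axis_def b_def norm_sgn)
  from max[OF this] have "Re (cnj (sgn b - v $ i) * b) \<le> 0"
    unfolding sesq_form_add_axis[OF B(1)] B(2) b_def[symmetric] by simp
  then have "cmod b \<le> Re (cnj (v $ i) * b)"
    by (simp only: cnj_sgn_mult complex_cnj_diff left_diff_distrib minus_complex.sel Re_complex_of_real)
  then have "cnj (v $ i) * b = of_real (cmod b)"
    using of_real_cmod_eqI[of "cnj (v $ i) * b"] v by (simp add: norm_mult torus_cmod)
  then have "v $ i * cnj (v $ i) * b = of_real (cmod b) * v $ i" by (simp add: mult.assoc mult.commute)
  then show ?thesis using v by (simp add: torus_mult_cnj b_def)
qed simp

lemma psd_unit_diag_entry:
  assumes Z: "psd Z" "\<And>i. Z $ i $ i = 1" and v: "v \<in> torus"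
  shows "Re (cnj (v $ i) * Z $ i $ j * v $ j) \<le> 1"
    and "Re (cnj (v $ i) * Z $ i $ j * v $ j) = 1 \<Longrightarrow> Z $ i $ j = outer v $ i $ j"
proof -
  have bound: "Re (cnj a * Z $ i $ j * b) \<le> 1" if "cmod a = 1" "cmod b = 1" for a b
  proof -
    have "0 \<le> Re (sesq_form Z (axis j b + axis i (- a)))" using Z by (simp only: psd_iff)
    then show ?thesis
      using that Z unfolding psd_iff by (subst (asm) sesq_form_axis_axis) simp_all
  qed
  show "Re (cnj (v $ i) * Z $ i $ j * v $ j) \<le> 1"
    using bound v by (simp only: torus_cmod)
  have "cmod (Z $ i $ j) \<le> 1"
  proof (cases "Z $ i $ j = 0")
    case False
    then have "Re (cnj (sgn (Z $ i $ j)) * Z $ i $ j * 1) \<le> 1"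
      by (intro bound) (simp_all add: norm_sgn)
    then show ?thesis by (simp only: cnj_sgn_mult mult.right_neutral Re_complex_of_real)
  qed simp
  moreover define q where "q = cnj (v $ i) * Z $ i $ j * v $ j"
  moreover assume "Re (cnj (v $ i) * Z $ i $ j * v $ j) = 1"
  ultimately have "Re q = 1" "cmod q \<le> 1"
    using v by (simp_all only: norm_mult torus_cmod complex_mod_cnj mult_1 mult_1_right)
  then have "q = 1"
    using of_real_cmod_eqI[of q] complex_Re_le_cmod[of q] by simp
  then have "cnj (v $ i) * Z $ i $ j * v $ j = 1" by (simp only: q_def)
  then have "(v $ i * cnj (v $ i)) * Z $ i $ j * (v $ j * cnj (v $ j)) = outer v $ i $ j"
    by (simp add: outer_def mult_ac)
  then show "Z $ i $ j = outer v $ i $ j" using v by (simp add: torus_mult_cnj)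
qed

lemma sesq_form_outer: "sesq_form (outer v) w = of_real ((cmod (\<Sum>i\<in>UNIV. cnj (v $ i) * w $ i))\<^sup>2)"
    unfolding complex_norm_square sesq_form_expand outer_def
    by (simp add: sum_product mult_ac)

lemma psd_outer: "psd (outer v)"
proof -
  have "hermitian (outer v)"
    by (rule hermitianI) (simp add: outer_def mult.commute)
  then show ?thesis by (simp add: psd_iff sesq_form_outer)
qed

lemma sdp_minimizer_dual_certificate:
  fixes L S :: "complex^'n^'n"
  assumes L: "\<And>i j. L $ i $ j = S $ i $ j + (if i = j then c i else 0)"
    and v: "v \<in> torus" and Sv: "sesq_form S v = 0" and \<epsilon>: "\<epsilon> > 0"
    and S: "\<And>w. \<epsilon> * ((norm w)\<^sup>2 - (cmod (\<Sum>i\<in>UNIV. cnj (v $ i) * w $ i))\<^sup>2 / CARD('n)) \<le> Re (sesq_form S w)"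
  shows "sdp_minimizer L Z \<longleftrightarrow> Z = outer v"
proof -
  define feas :: "complex^'n^'n \<Rightarrow> bool" where
    "feas Z \<longleftrightarrow> hermitian Z \<and> (\<forall>i. Z $ i $ i = 1) \<and> psd Z" for Z
  define d where "d = real CARD('n)"
  have d: "d > 0" by (simp add: d_def)
  have obj: "trace (L ** Z) = trace (S ** Z) + (\<Sum>i\<in>UNIV. c i)" if "feas Z" for Z
    using that by (simp add: trace_mult_expand L feas_def algebra_simps sum.distrib
        if_distrib[of "\<lambda>c. _ * c"] cong: if_cong)
  have outer: "feas (outer v)"
    using psd_outer[of v] v by (auto simp: feas_def psd_iff outer_def torus_mult_cnj)
  define P where "P = S - \<epsilon> *\<^sub>R (mat 1 - (1 / d) *\<^sub>R outer v)"
  have Pnth: "P $ i $ j = S $ i $ j - of_real \<epsilon> * (mat 1 $ i $ j - of_real (1 / d) * outer v $ i $ j)" for i j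
    by (simp add: P_def) (simp add: scaleR_conv_of_real)
  have "sesq_form P w = sesq_form S w - of_real (\<epsilon> * ((norm w)\<^sup>2 - (cmod (\<Sum>i\<in>UNIV. cnj (v $ i) * w $ i))\<^sup>2 / d))" for w
  proof -
    have "sesq_form (mat 1) w = of_real ((norm w)\<^sup>2)"
      unfolding sesq_form_def sum_cmod_power2[symmetric] of_real_sum complex_norm_square
      by (simp add: mult.commute)
    moreover have "sesq_form P w = sesq_form S w - of_real \<epsilon> * (sesq_form (mat 1) w - of_real (1 / d) * sesq_form (outer v) w)"
      by (simp add: Pnth sesq_form_expand sum_subtractf sum.distrib algebra_simps
          sum_distrib_left sum_divide_distrib)
    ultimately show ?thesis by (simp add: sesq_form_outer)
  qed
  then have "0 \<le> Re (sesq_form P w)" for w using S[of w] by (simp add: d_def)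
  then have tr: "0 \<le> Re (trace (P ** Z))" if "feas Z" for Z
    using that trace_mult_psd_nonneg[of P Z] by (simp add: feas_def)
  define gap where "gap Z = (\<Sum>i\<in>UNIV. \<Sum>j\<in>UNIV. 1 - Re (cnj (v $ i) * Z $ i $ j * v $ j))" for Z
  have gap: "\<epsilon> / d * gap Z \<le> Re (trace (S ** Z))" if Z: "feas Z" for Z
  proof -
    have "trace (mat 1 ** Z) = of_real d" using Z by (simp add: trace_def feas_def d_def)
    moreover have "trace (P ** Z) = trace (S ** Z) - of_real \<epsilon> * (trace (mat 1 ** Z) - of_real (1 / d) * trace (outer v ** Z))"
      by (simp add: Pnth trace_mult_expand algebra_simps sum_subtractf sum.distrib
          sum_distrib_left sum_divide_distrib del: matrix_mul_lid)
    ultimately have "Re (trace (P ** Z)) = Re (trace (S ** Z)) - \<epsilon> * (d - Re (sesq_form Z v) / d)"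
      unfolding trace_outer_mult by simp
    moreover have "gap Z = d * d - Re (sesq_form Z v)"
      by (simp add: gap_def sesq_form_expand d_def sum_subtractf)
    then have "\<epsilon> / d * gap Z = \<epsilon> * (d - Re (sesq_form Z v) / d)" using d
      by (simp add: right_diff_distrib diff_divide_distrib)
    ultimately show ?thesis using tr[OF Z] by linarith
  qed
  have entry: "0 \<le> 1 - Re (cnj (v $ i) * Z $ i $ j * v $ j)" if "feas Z" for Z i j
    using that psd_unit_diag_entry(1)[of Z v i j] v by (simp only: feas_def) simp
  have gap0: "0 \<le> gap Z" if "feas Z" for Z
    unfolding gap_def by (intro sum_nonneg entry[OF that])
  have uniq: "Z = outer v" if Z: "feas Z" and "gap Z \<le> 0" for Z
  proof -
    have "gap Z = 0" using gap0[OF Z] that by simp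
    then have "1 - Re (cnj (v $ i) * Z $ i $ j * v $ j) = 0" for i j
      unfolding gap_def using entry[OF Z]
      by (subst (asm) sum_nonneg_eq_0_iff; (simp add: sum_nonneg)?)
        (subst (asm) sum_nonneg_eq_0_iff; simp)
    then show ?thesis
      using psd_unit_diag_entry(2)[of Z v] Z v by (auto simp: feas_def vec_eq_iff)
  qed
  have min: "sdp_minimizer L Z \<longleftrightarrow> feas Z \<and> (\<forall>Y. feas Y \<longrightarrow> Re (trace (S ** Z)) \<le> Re (trace (S ** Y)))"
    unfolding sdp_minimizer_def is_arg_min_def feas_def[symmetric]
    by (auto simp: obj not_less)
  have pos: "0 \<le> \<epsilon> / d * gap Y" if "feas Y" for Y using gap0[OF that] \<epsilon> d by simp
  show ?thesis
  proof
    assume "sdp_minimizer L Z"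
    then have Z: "feas Z" "Re (trace (S ** Z)) \<le> 0"
      using outer Sv unfolding min by (auto simp: trace_mult_outer dest: spec[of _ "outer v"])
    then have "\<epsilon> / d * gap Z \<le> 0" using gap by fastforce
    then show "Z = outer v" using \<epsilon> d by (intro uniq Z) (simp add: field_simps mult_le_0_iff)
  next
    assume "Z = outer v"
    then show "sdp_minimizer L Z"
      unfolding min using outer gap pos by (auto simp: trace_mult_outer Sv intro: order_trans)
  qed
qed

lemma Re_sesq_form_le_spectral_norm: "Re (sesq_form A u) \<le> spectral_norm A * (norm u)\<^sup>2"
proof -
  have "Re (sesq_form A u) = u \<bullet> (A *v u)"
    by (simp add: sesq_form_def inner_vec_def inner_complex_def)
  also have "\<dots> \<le> norm u * norm (A *v u)" by (rule norm_cauchy_schwarz)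
  also have "\<dots> \<le> norm u * (spectral_norm A * norm u)"
    unfolding spectral_norm_def by (intro mult_left_mono onorm) auto
  finally show ?thesis by (simp add: power2_eq_square mult_ac)
qed

lemma spectral_norm_entry_bound:
  fixes v :: "complex^'n"
  assumes "v \<in> torus"
  shows "cmod ((A *v v) $ i) \<le> spectral_norm A * sqrt (real CARD('n))"
proof -
  have "norm v = sqrt (real CARD('n))" by (metis assms norm_ge_zero real_sqrt_unique torus_norm)
  moreover have "norm (A *v v) \<le> spectral_norm A * norm v"
    unfolding spectral_norm_def by (intro onorm) auto
  ultimately show ?thesis using Finite_Cartesian_Product.norm_nth_le[of "A *v v" i] by simp
qed

text \<open>The multipliers \<open>\<mu> i\<close> come from optimality of \<open>v\<close> in each coordinate separately. They
  differ from the degrees by the entries of \<open>\<Delta> *v v\<close> up to phases, where \<open>\<Delta>\<close> is the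
  residual; this accounts for \<open>sqrt d\<close> in the threshold, and the \<open>1\<close> for \<open>\<Delta>\<close> itself.\<close>
lemma sdp_minimizer_iff_outer:
  fixes W :: "real^'n^'n" and v :: "complex^'n"
  assumes W: "weighted_graph E W" and two: "2 \<le> CARD('n)" and pos: "spectral_gap E W > 0"
    and Yh: "hermitian Y" and Y1: "\<And>l j. W $ l $ j \<noteq> 0 \<Longrightarrow> cmod (Y $ l $ j) = 1"
    and min: "least_squares_minimizer (noisy_laplacian E W Y) v"
    and small: "spectral_norm (cmat_of W \<odot> (Y - outer v)) < spectral_gap E W / (1 + sqrt (real CARD('n)))"
  shows "sdp_minimizer (noisy_laplacian E W Y) Z \<longleftrightarrow> Z = outer v"
proof -
  define d where "d = real CARD('n)"
  define \<tau> where "\<tau> = spectral_gap E W"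
  define B where "B = cmat_of W \<odot> Y"
  define \<Delta> where "\<Delta> = cmat_of W \<odot> (Y - outer v)"
  define \<delta> where "\<delta> = spectral_norm \<Delta>"
  define deg where "deg i = (\<Sum>j\<in>UNIV. W $ i $ j)" for i
  have v: "v \<in> torus" using min by (simp add: least_squares_minimizer_def is_arg_min_def)
  have Bnth: "B $ i $ j = W $ i $ j * Y $ i $ j" for i j
    by (simp add: B_def hadamard_def cmat_of_def)
  have Lnth: "noisy_laplacian E W Y' $ i $ j = (if i = j then of_real (deg i) else 0) - W $ i $ j * Y' $ i $ j" for Y' i j
    by (simp add: noisy_laplacian_def degree_matrix_eq[OF W] hadamard_def cmat_of_def deg_def)
  have Bh: "hermitian B"
    by (rule hermitianI) (simp add: Bnth hermitian_nth[OF Yh] weighted_graph_symmetric[OF W])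
  have B0: "B $ i $ i = 0" for i using W by (simp add: Bnth weighted_graph_def)
  have diag_form: "sesq_form A w = (\<Sum>i\<in>UNIV. of_real (a i * (cmod (w $ i))\<^sup>2)) - sesq_form C w"
    if "\<And>i j. A $ i $ j = (if i = j then of_real (a i) else 0) - C $ i $ j" for A C a w
  proof -
    have norm: "of_real (a i * (cmod (w $ i))\<^sup>2) = cnj (w $ i) * of_real (a i) * w $ i" for i
      by (simp only: of_real_mult complex_norm_square mult_ac)
    show ?thesis
      unfolding norm by (simp add: sesq_form_expand that algebra_simps sum_subtractf sum.distrib
          if_distrib[of "\<lambda>c. _ * c"] cong: if_cong)
  qed
  have max: "Re (sesq_form B w) \<le> Re (sesq_form B v)" if w: "w \<in> torus" for w
  proof -
    have "Re (sesq_form (noisy_laplacian E W Y) u) = (\<Sum>i\<in>UNIV. deg i) - Re (sesq_form B u)" if "u \<in> torus" for u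
      using that by (subst diag_form[of _ deg B]) (simp_all add: Lnth Bnth torus_cmod)
    moreover have "Re (sesq_form (noisy_laplacian E W Y) v) \<le> Re (sesq_form (noisy_laplacian E W Y) w)"
      using min w by (auto simp: least_squares_minimizer_def is_arg_min_def not_less)
    ultimately show ?thesis using v w by simp
  qed
  define \<mu> where "\<mu> i = cmod ((B *v v) $ i)" for i
  have Bv: "(B *v v) $ i = of_real (\<mu> i) * v $ i" for i
    unfolding \<mu>_def by (rule torus_maximizer_mult[OF Bh B0 v max])
  define S :: "complex^'n^'n" where "S = (\<chi> i j. (if i = j then of_real (\<mu> i) else 0) - B $ i $ j)"
  have Sh: "hermitian S"
    by (rule hermitianI) (auto simp: S_def hermitian_nth[OF Bh])
  have Sv: "S *v v = 0"
  proof -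
    have "(S *v v) $ i = of_real (\<mu> i) * v $ i - (B *v v) $ i" for i
      by (simp add: S_def matrix_vector_mult_def left_diff_distrib sum_subtractf
          if_distrib[of "\<lambda>c. c * _"] cong: if_cong)
    then show ?thesis by (simp add: Bv vec_eq_iff)
  qed
  have mu_deg: "\<bar>\<mu> i - deg i\<bar> \<le> \<delta> * sqrt d" for i
  proof -
    have "(\<Delta> *v v) $ i = (B *v v) $ i - (\<Sum>j\<in>UNIV. W $ i $ j * (v $ i * (cnj (v $ j) * v $ j)))"
      by (simp add: \<Delta>_def B_def hadamard_def cmat_of_def outer_def matrix_vector_mult_def
          algebra_simps sum_subtractf)
    also have "\<dots> = of_real (\<mu> i - deg i) * v $ i"
      by (simp add: torus_mult_cnj[OF v] Bv deg_def left_diff_distrib sum_distrib_right)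
    finally have "\<bar>\<mu> i - deg i\<bar> = cmod ((\<Delta> *v v) $ i)"
      using v by (simp only: norm_mult norm_of_real torus_cmod) simp
    then show ?thesis using spectral_norm_entry_bound[OF v, of \<Delta> i] by (simp add: \<delta>_def d_def)
  qed
  define \<epsilon> where "\<epsilon> = \<tau> - (1 + sqrt d) * \<delta>"
  have "\<delta> < \<tau> / (1 + sqrt d)" using small by (simp add: \<delta>_def \<Delta>_def \<tau>_def d_def)
  moreover have "0 < 1 + sqrt d" by (simp add: d_def add_pos_nonneg)
  ultimately have \<epsilon>: "\<epsilon> > 0" by (simp add: \<epsilon>_def less_divide_eq mult.commute)
  have perp: "\<epsilon> * (norm u)\<^sup>2 \<le> Re (sesq_form S u)" if u: "(\<Sum>i\<in>UNIV. cnj (v $ i) * u $ i) = 0" for u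
  proof -
    have "cmod (outer v $ l $ j) = 1" for l j
      using v by (simp add: outer_def norm_mult torus_cmod)
    then have gap: "\<tau> * (norm u)\<^sup>2 \<le> Re (sesq_form (noisy_laplacian E W (outer v)) u)"
      using edge_energy_gap[OF W two pos v, of u] u
      by (simp add: sesq_form_noisy_laplacian[OF W] \<tau>_def)
    have "sesq_form S u = (\<Sum>i\<in>UNIV. of_real ((\<mu> i - deg i) * (cmod (u $ i))\<^sup>2))
      - sesq_form (\<Delta> - noisy_laplacian E W (outer v)) u"
      by (rule diag_form) (simp add: S_def Lnth Bnth \<Delta>_def hadamard_def cmat_of_def algebra_simps)
    also have "sesq_form (\<Delta> - noisy_laplacian E W (outer v)) u
      = sesq_form \<Delta> u - sesq_form (noisy_laplacian E W (outer v)) u"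
      by (simp add: sesq_form_expand algebra_simps sum_subtractf)
    finally have S: "Re (sesq_form S u) = (\<Sum>i\<in>UNIV. (\<mu> i - deg i) * (cmod (u $ i))\<^sup>2) - Re (sesq_form \<Delta> u)
      + Re (sesq_form (noisy_laplacian E W (outer v)) u)"
      by simp
    have "(\<Sum>i\<in>UNIV. - (\<delta> * sqrt d) * (cmod (u $ i))\<^sup>2) \<le> (\<Sum>i\<in>UNIV. (\<mu> i - deg i) * (cmod (u $ i))\<^sup>2)"
      using mu_deg by (intro sum_mono mult_right_mono) (simp_all add: abs_le_iff, smt (verit))
    then have "- (\<delta> * sqrt d) * (norm u)\<^sup>2 \<le> (\<Sum>i\<in>UNIV. (\<mu> i - deg i) * (cmod (u $ i))\<^sup>2)"
      by (simp only: sum_cmod_power2 flip: sum_distrib_left)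
    moreover have "Re (sesq_form \<Delta> u) \<le> \<delta> * (norm u)\<^sup>2"
      unfolding \<delta>_def by (rule Re_sesq_form_le_spectral_norm)
    ultimately show ?thesis using gap unfolding S \<epsilon>_def by (simp add: algebra_simps)
  qed
  have form: "\<epsilon> * ((norm w)\<^sup>2 - (cmod (\<Sum>i\<in>UNIV. cnj (v $ i) * w $ i))\<^sup>2 / CARD('n)) \<le> Re (sesq_form S w)" for w
  proof -
    define s where "s = (\<Sum>i\<in>UNIV. cnj (v $ i) * w $ i)"
    define p where "p = (s / of_real d) *s v"
    define u where "u = w - p"
    have d0: "d \<noteq> 0" by (simp add: d_def)
    have "S *v p = 0" by (simp add: p_def vector_scalar_commute Sv)
    then have "Re (sesq_form S (p + u)) = Re (sesq_form S u)"
      unfolding sesq_form_add[OF Sh] by (simp add: sesq_form_def)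
    then have Sw: "Re (sesq_form S w) = Re (sesq_form S u)" by (simp add: u_def)
    have "(\<Sum>i\<in>UNIV. cnj (v $ i) * p $ i) = (\<Sum>i\<in>(UNIV::'n set). s / of_real d)"
      by (rule sum.cong) (simp_all add: p_def torus_mult_cnj[OF v])
    then have u0: "(\<Sum>i\<in>UNIV. cnj (v $ i) * u $ i) = 0"
      using d0 by (simp add: u_def right_diff_distrib sum_subtractf d_def flip: s_def)
    have "(cmod (w $ i))\<^sup>2 = (cmod (u $ i))\<^sup>2 + (cmod (p $ i))\<^sup>2 + 2 * Re (cnj (s / of_real d) * (cnj (v $ i) * u $ i))" for i
    proof -
      have "w $ i = p $ i - - u $ i" by (simp add: u_def)
      then have "(cmod (w $ i))\<^sup>2 = (cmod (u $ i))\<^sup>2 + (cmod (p $ i))\<^sup>2 + 2 * Re (cnj (p $ i) * u $ i)"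
        by (simp only: cmod_diff_power2 norm_minus_cancel mult_minus_right uminus_complex.sel)
      also have "cnj (p $ i) * u $ i = cnj (s / of_real d) * (cnj (v $ i) * u $ i)"
        by (simp add: p_def)
      finally show ?thesis .
    qed
    then have "(norm w)\<^sup>2 = (norm u)\<^sup>2 + (norm p)\<^sup>2 + 2 * Re (cnj (s / of_real d) * (\<Sum>i\<in>UNIV. cnj (v $ i) * u $ i))"
      unfolding sum_distrib_left Re_sum by (simp only: sum.distrib flip: sum_cmod_power2)
    moreover have "(norm p)\<^sup>2 = (\<Sum>i\<in>(UNIV :: 'n set). (cmod s / d)\<^sup>2)"
      unfolding sum_cmod_power2[symmetric] using v
      by (intro sum.cong) (simp_all add: p_def norm_mult norm_divide torus_cmod d_def)
    then have "(norm p)\<^sup>2 = (cmod s)\<^sup>2 / d" by (simp add: d_def power2_eq_square)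
    ultimately have "(norm u)\<^sup>2 = (norm w)\<^sup>2 - (cmod s)\<^sup>2 / d" using u0 by simp
    then show ?thesis using perp[OF u0] unfolding Sw s_def d_def by simp
  qed
  show ?thesis
  proof (rule sdp_minimizer_dual_certificate[OF _ v _ \<epsilon> form])
    show "noisy_laplacian E W Y $ i $ j = S $ i $ j + (if i = j then of_real (deg i - \<mu> i) else 0)" for i j
      by (simp add: Lnth S_def Bnth)
    show "sesq_form S v = 0" by (simp add: sesq_form_def Sv)
  qed
qed

theorem theorem3p1:
  fixes E :: "('n::finite \<times> 'n) set" and W R :: "real ^ 'n ^ 'n"
    and \<eta> :: "real ^ 'n ^ 'n"
    and N X Xh Lh :: "complex ^ 'n ^ 'n"
    and x xt z :: "complex ^ 'n"
    and \<tau> c\<^sub>z :: real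
  assumes two_vertices: "2 \<le> CARD('n)"
    and graph: "weighted_graph E W"
    and tau: "\<tau> = spectral_gap E W"
    and tau_pos: "\<tau> > 0"
    and x: "x \<in> torus"
    and eta: "\<And>l j. \<eta> $ l $ j \<in> {-pi<..pi}"
    and N: "\<And>l j. N $ l $ j = exp (\<i> * complex_of_real (\<eta> $ l $ j))"
    and N_herm: "hermitian N"
    and X: "X = phase_matrix E x"
    and Xh: "Xh = X \<odot> N"
    and Lh: "Lh = noisy_laplacian E W Xh"
    and xt: "least_squares_minimizer Lh xt"
    and z: "eigenvector_minimizer Lh z"
    and R: "R = (\<chi> l j. sqrt (W $ l $ j))"
    and cz: "c\<^sub>z = sqrt (2 + 2 * (linf_norm z)\<^sup>2)"
  shows "(\<exists>m. is_min_phase_dist xt x m \<and>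
            m \<le> 2 * (frob_norm (cmat_of R \<odot> (Xh - X)) / sqrt \<tau>)) \<and>
         (\<exists>m. is_min_phase_dist (sgn_vec z) x m \<and>
            m \<le> 2 * (c\<^sub>z * frob_norm (cmat_of R \<odot> (Xh - X)) / sqrt \<tau>)) \<and>
         (spectral_norm (cmat_of W \<odot> (Xh - outer xt)) < \<tau> / (1 + sqrt (real CARD('n))) \<longrightarrow>
            (\<forall>Z. sdp_minimizer Lh Z \<longleftrightarrow> Z = outer xt))"
proof -
  have gap: "spectral_gap E W > 0" using tau tau_pos by simp
  have edge: "(l, j) \<in> E" if "W $ l $ j \<noteq> 0" for l j
    using graph that unfolding weighted_graph_def by blast
  have Xh_nth: "Xh $ l $ j = X $ l $ j * N $ l $ j" for l j by (simp add: Xh hadamard_def)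
  have X_nth: "X $ l $ j = outer x $ l $ j" if "W $ l $ j \<noteq> 0" for l j
    using edge[OF that] by (simp add: X phase_matrix_def outer_def)
  have Xh1: "cmod (Xh $ l $ j) = 1" if "W $ l $ j \<noteq> 0" for l j
    using X_nth[OF that] x by (simp add: Xh_nth N outer_def norm_mult torus_cmod)
  have "sym E" using graph by (simp add: weighted_graph_def)
  then have "cnj (X $ l $ j) = X $ j $ l" for l j
    by (auto simp: X phase_matrix_def mult.commute dest: symD)
  then have Xh_herm: "hermitian Xh"
    by (intro hermitianI) (simp add: Xh_nth hermitian_nth[OF N_herm])
  have energy: "Re (sesq_form Lh v) = edge_energy W Xh v" for v
    unfolding Lh by (rule sesq_form_noisy_laplacian[OF graph Xh1])
  define F where "F = frob_norm (cmat_of R \<odot> (Xh - X))"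
  have "cmod ((cmat_of R \<odot> (Xh - X)) $ l $ j) = sqrt (W $ l $ j) * cmod (Xh $ l $ j - outer x $ l $ j)" for l j
  proof (cases "W $ l $ j = 0")
    case False
    moreover have "0 \<le> W $ l $ j" using graph by (simp add: weighted_graph_def)
    ultimately show ?thesis
      by (simp add: hadamard_def cmat_of_def R X_nth norm_mult)
  qed (simp add: hadamard_def cmat_of_def R)
  then have F: "F = L2_set (\<lambda>(l, j). sqrt (W $ l $ j) * cmod (Xh $ l $ j - outer x $ l $ j)) UNIV"
    by (simp add: F_def frob_norm_L2_set)
  then have F0: "0 \<le> F" by (simp add: L2_set_nonneg)

  have xt_torus: "xt \<in> torus"
    using xt by (simp add: least_squares_minimizer_def is_arg_min_def)
  have "edge_energy W Xh xt \<le> edge_energy W Xh x"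
    using xt x unfolding least_squares_minimizer_def is_arg_min_def energy by (auto simp: not_less)
  then obtain m1 where m1: "is_min_phase_dist xt x m1" "m1 \<le> (1 + 1) * F / sqrt \<tau>"
    using phase_dist_bound[OF graph two_vertices gap x torus_norm[OF xt_torus] _ _ F, of 1]
    unfolding tau by (metis order_refl torus_cmod xt_torus)

  define M where "M = linf_norm z"
  have M: "cmod (z $ j) \<le> M" for j
    unfolding M_def linf_norm_def by (rule Max_ge) auto
  have z_norm: "(norm z)\<^sup>2 = CARD('n)"
    using z by (simp add: eigenvector_minimizer_def is_arg_min_def)
  have "edge_energy W Xh z \<le> edge_energy W Xh x"
    using z torus_norm[OF x]
    unfolding eigenvector_minimizer_def is_arg_min_def energy by (auto simp: not_less)
  then obtain m2 where m2: "is_min_phase_dist z x m2" "m2 \<le> (1 + M) * F / sqrt \<tau>"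
    using phase_dist_bound[OF graph two_vertices gap x z_norm M _ F] unfolding tau by metis
  obtain m3 where m3: "is_min_phase_dist (sgn_vec z) x m3"
    using is_min_phase_dist_explicit by blast
  obtain \<theta> where \<theta>: "\<theta> \<in> {0..<2 * pi}" "m2 = norm (z - exp (\<i> * complex_of_real \<theta>) *s x)"
    using m2(1) unfolding is_min_phase_dist_def is_arg_min_def by blast
  have "1 + M \<le> c\<^sub>z"
    unfolding cz M_def[symmetric]
    by (rule real_le_rsqrt) (use zero_le_power2[of "1 - M"] in \<open>simp add: power2_eq_square algebra_simps\<close>)
  then have "(1 + M) * F / sqrt \<tau> \<le> c\<^sub>z * F / sqrt \<tau>"
    using F0 tau_pos by (intro divide_right_mono mult_right_mono) auto
  with m2(2) have m2_le: "2 * m2 \<le> 2 * (c\<^sub>z * F / sqrt \<tau>)" by simp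
  have "m3 \<le> norm (sgn_vec z - exp (\<i> * complex_of_real \<theta>) *s x)"
    using m3 \<theta>(1) unfolding is_min_phase_dist_def is_arg_min_def by (metis not_less)
  also have "\<dots> \<le> 2 * m2"
    unfolding \<theta>(2) using x by (intro norm_sgn_vec_diff_le) (simp add: torus_def norm_mult)
  also note m2_le
  finally have "m3 \<le> 2 * (c\<^sub>z * F / sqrt \<tau>)" .
  moreover have "sdp_minimizer Lh Z \<longleftrightarrow> Z = outer xt"
    if "spectral_norm (cmat_of W \<odot> (Xh - outer xt)) < \<tau> / (1 + sqrt (real CARD('n)))" for Z
    using sdp_minimizer_iff_outer[OF graph two_vertices gap Xh_herm Xh1] xt that
    unfolding Lh tau by blast
  ultimately show ?thesis
    using m1 m3 by (auto simp flip: F_def)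
qed

end
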